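(* Let $\Lambda$ be a locally convex row-finite $k$-graph. Suppose that there is a function $v\mapsto n_v$ from $\Lambda^0$ to $\mathbb{N}^k$ such that for each $v\in\Lambda^0$ and each $\lambda\in v\Lambda^{\le n_v}$, $s(\lambda)$ lies on an end of $\Lambda$. (a) If $g:\Lambda^0\to\mathbb{R}^+$ is a $k$-graph trace, then there is a well-defined function from $\mathrm{Ends}(\Lambda)/\!\sim$ to $\mathbb{R}^+$ satisfying $g([x]):=g(x(0))$, and $$g(v)=\sum_{\lambda\in v\Lambda^{\le n_v}}g([x_{s(\lambda)}])\quad\text{for every }v\in\Lambda^0.$$ (b) Conversely, given any function $g$ from $\mathrm{Ends}(\Lambda)/\!\sim$ to $\mathbb{R}^+$, there is a unique $k$-graph trace $\overline g$ on $\Lambda$ satisfying $\overline g(x(0))=g([x])$ for all $x\in\mathrm{Ends}(\Lambda)$.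
   Context: $\mathbb{N}^k$ has generators $e_1,\dots,e_k$ and coordinatewise order; $\mathbb{R}^+=[0,\infty)$. A $k$-graph $(\Lambda,d)$ is a countable category $\Lambda$ with a functor $d:\Lambda\to\mathbb{N}^k$ such that if $d(\lambda)=m+n$ there are unique $\mu,\nu$ with $d(\mu)=m$, $d(\nu)=n$, $\lambda=\mu\nu$. Objects are identified with identity morphisms (the morphisms of degree $0$). $\Lambda$ is regarded as its set of morphisms (paths), $\Lambda^n=d^{-1}(n)$, $\Lambda^0$ = vertices; $r,s$ are codomain and domain. For $S\subset\Lambda$, $vS=\{\lambda\in S:r(\lambda)=v\}$. Row-finite: $|v\Lambda^n|<\infty$ for all $v,n$. Locally convex: for $e\in\Lambda^{e_i}$, $j\ne i$, $s(e)\Lambda^{e_j}=\emptyset$ only if $r(e)\Lambda^{e_j}=\emptyset$. $\Lambda^{\le n}$ is the set of $\lambda$ with $d(\lambda)\le n$ such that $\mu\in s(\lambda)\Lambda$, $d(\lambda\mu)\le n$ imply $\mu=s(\lambda)$. A $k$-graph trace on $\Lambda$ is a function $g:\Lambda^0\to\mathbb{R}^+$ with $g(v)=\sum_{\lambda\in v\Lambda^{\le n}}g(s(\lambda))$ for all $v\in\Lambda^0$, $n\in\mathbb{N}^k$. For $m\in(\mathbb{N}\cup\{\infty\})^k$, $\Omega_{k,m}$ is the $k$-graph with vertices $\{n\in\mathbb{N}^k:n\le m\}$ and morphisms the pairs $(p,q)$ of vertices with $p\le q$, of degree $q-p$, with $r(p,q)=p$, $s(p,q)=q$, $(p,q)(q,n)=(p,n)$.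 A boundary path of $\Lambda$ is a degree-preserving functor $x:\Omega_{k,m}\to\Lambda$ such that if $m_i<\infty$, $n\le m$ and $n_i=m_i$, then $x(n)\Lambda^{e_i}=\emptyset$; write $d(x)=m$, $r(x)=x(0)$, and $x(n)$ for the vertex at $n$. An end of $\Lambda$ is a boundary path $x$ with $r(x)\Lambda^n=\{x(0,n)\}$ for all $n\in\mathbb{N}^k$ with $n\le d(x)$; $\mathrm{Ends}(\Lambda)$ is the set of ends. For ends $x,y$, write $x\sim y$ iff $x(n)=y(m)$ for some $n\le d(x)$, $m\le d(y)$; this is an equivalence relation with classes $[x]$. A vertex lies on an end $x$ if it equals $x(n)$ for some $n\le d(x)$; if $v$ lies on an end, then there is exactly one boundary path with range $v$, denoted $x_v$, and it is itself an end. *)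

theory Defs
  imports
    Complex_Main
    "HOL-Library.FuncSet"
    "HOL-Library.Countable_Set"
    "HOL-Library.Extended_Nat"
    "HOL-Library.Function_Algebras"
begin

text \<open>
  The monoid \<open>\<nat>\<^sup>k\<close> is the function type \<^typ>\<open>'k \<Rightarrow> nat\<close> over a finite index type \<open>'k\<close> with
  \<open>k\<close> elements, with its pointwise order and arithmetic; \<open>(\<nat> \<union> {\<infinity>})\<^sup>k\<close> is \<open>'k \<Rightarrow> enat\<close>.
\<close>

definition gen :: "'k \<Rightarrow> 'k \<Rightarrow> nat" where
  "gen i = (\<lambda>j. if j = i then 1 else 0)"

definition le_enat :: "('k \<Rightarrow> nat) \<Rightarrow> ('k \<Rightarrow> enat) \<Rightarrow> bool" where
  "le_enat n m \<longleftrightarrow> (\<forall>i. enat (n i) \<le> m i)"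

text \<open>
  Categories are one-sorted: only morphisms are represented, and an object is its identity
  morphism. So \<open>rng\<close> and \<open>src\<close> (codomain and domain) send a morphism to an identity morphism,
  and \<open>cmp \<Lambda> \<mu> \<nu>\<close> is the composite \<open>\<mu>\<nu>\<close>, meaningful only when \<open>src \<Lambda> \<mu> = rng \<Lambda> \<nu>\<close>.
\<close>

record ('a, 'k) kgraph_data =
  paths :: "'a set"
  rng :: "'a \<Rightarrow> 'a"
  src :: "'a \<Rightarrow> 'a"
  cmp :: "'a \<Rightarrow> 'a \<Rightarrow> 'a"
  deg :: "'a \<Rightarrow> 'k \<Rightarrow> nat"

locale k_graph =
  fixes \<Lambda> :: "('a, 'k::finite) kgraph_data"
  assumes countable_paths: "countable (paths \<Lambda>)"
    and rng_closed: "l \<in> paths \<Lambda> \<Longrightarrow> rng \<Lambda> l \<in> paths \<Lambda>"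
    and src_closed: "l \<in> paths \<Lambda> \<Longrightarrow> src \<Lambda> l \<in> paths \<Lambda>"
    and rng_rng: "l \<in> paths \<Lambda> \<Longrightarrow> rng \<Lambda> (rng \<Lambda> l) = rng \<Lambda> l"
    and src_rng: "l \<in> paths \<Lambda> \<Longrightarrow> src \<Lambda> (rng \<Lambda> l) = rng \<Lambda> l"
    and rng_src: "l \<in> paths \<Lambda> \<Longrightarrow> rng \<Lambda> (src \<Lambda> l) = src \<Lambda> l"
    and src_src: "l \<in> paths \<Lambda> \<Longrightarrow> src \<Lambda> (src \<Lambda> l) = src \<Lambda> l"
    and cmp_closed: "\<mu> \<in> paths \<Lambda> \<Longrightarrow> \<nu> \<in> paths \<Lambda> \<Longrightarrow> src \<Lambda> \<mu> = rng \<Lambda> \<nu> \<Longrightarrow> cmp \<Lambda> \<mu> \<nu> \<in> paths \<Lambda>"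
    and rng_cmp: "\<mu> \<in> paths \<Lambda> \<Longrightarrow> \<nu> \<in> paths \<Lambda> \<Longrightarrow> src \<Lambda> \<mu> = rng \<Lambda> \<nu> \<Longrightarrow> rng \<Lambda> (cmp \<Lambda> \<mu> \<nu>) = rng \<Lambda> \<mu>"
    and src_cmp: "\<mu> \<in> paths \<Lambda> \<Longrightarrow> \<nu> \<in> paths \<Lambda> \<Longrightarrow> src \<Lambda> \<mu> = rng \<Lambda> \<nu> \<Longrightarrow> src \<Lambda> (cmp \<Lambda> \<mu> \<nu>) = src \<Lambda> \<nu>"
    and cmp_assoc: "l \<in> paths \<Lambda> \<Longrightarrow> \<mu> \<in> paths \<Lambda> \<Longrightarrow> \<nu> \<in> paths \<Lambda> \<Longrightarrow>
      src \<Lambda> l = rng \<Lambda> \<mu> \<Longrightarrow> src \<Lambda> \<mu> = rng \<Lambda> \<nu> \<Longrightarrow>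
      cmp \<Lambda> (cmp \<Lambda> l \<mu>) \<nu> = cmp \<Lambda> l (cmp \<Lambda> \<mu> \<nu>)"
    and cmp_rng: "l \<in> paths \<Lambda> \<Longrightarrow> cmp \<Lambda> (rng \<Lambda> l) l = l"
    and cmp_src: "l \<in> paths \<Lambda> \<Longrightarrow> cmp \<Lambda> l (src \<Lambda> l) = l"
    and deg_rng: "l \<in> paths \<Lambda> \<Longrightarrow> deg \<Lambda> (rng \<Lambda> l) = 0"
    and deg_src: "l \<in> paths \<Lambda> \<Longrightarrow> deg \<Lambda> (src \<Lambda> l) = 0"
    and deg_cmp: "\<mu> \<in> paths \<Lambda> \<Longrightarrow> \<nu> \<in> paths \<Lambda> \<Longrightarrow> src \<Lambda> \<mu> = rng \<Lambda> \<nu> \<Longrightarrow>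
      deg \<Lambda> (cmp \<Lambda> \<mu> \<nu>) = deg \<Lambda> \<mu> + deg \<Lambda> \<nu>"
    and factorisation: "l \<in> paths \<Lambda> \<Longrightarrow> deg \<Lambda> l = m + n \<Longrightarrow>
      \<exists>!(\<mu>, \<nu>). \<mu> \<in> paths \<Lambda> \<and> \<nu> \<in> paths \<Lambda> \<and> src \<Lambda> \<mu> = rng \<Lambda> \<nu> \<and>
        deg \<Lambda> \<mu> = m \<and> deg \<Lambda> \<nu> = n \<and> l = cmp \<Lambda> \<mu> \<nu>"

definition paths_deg :: "('a, 'k) kgraph_data \<Rightarrow> ('k \<Rightarrow> nat) \<Rightarrow> 'a set" where
  "paths_deg \<Lambda> n = {l \<in> paths \<Lambda>. deg \<Lambda> l = n}"

abbreviation vertices :: "('a, 'k) kgraph_data \<Rightarrow> 'a set" where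
  "vertices \<Lambda> \<equiv> paths_deg \<Lambda> 0"

lemma (in k_graph) vertices_eq_identities:
  "vertices \<Lambda> = {v \<in> paths \<Lambda>. rng \<Lambda> v = v}"
proof (intro equalityI subsetI)
  fix v assume "v \<in> vertices \<Lambda>"
  then have v: "v \<in> paths \<Lambda>" "deg \<Lambda> v = 0 + 0"
    by (auto simp: paths_deg_def)
  let ?P = "\<lambda>(\<mu>, \<nu>). \<mu> \<in> paths \<Lambda> \<and> \<nu> \<in> paths \<Lambda> \<and> src \<Lambda> \<mu> = rng \<Lambda> \<nu> \<and>
        deg \<Lambda> \<mu> = 0 \<and> deg \<Lambda> \<nu> = 0 \<and> v = cmp \<Lambda> \<mu> \<nu>"
  have "?P (rng \<Lambda> v, v)" "?P (v, src \<Lambda> v)"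
    using v by (simp_all add: rng_closed src_closed src_rng rng_src deg_rng deg_src cmp_rng cmp_src)
  then have "(rng \<Lambda> v, v) = (v, src \<Lambda> v)"
    using factorisation[OF v] by blast
  then show "v \<in> {v \<in> paths \<Lambda>. rng \<Lambda> v = v}"
    using v by simp
next
  fix v assume "v \<in> {v \<in> paths \<Lambda>. rng \<Lambda> v = v}"
  then show "v \<in> vertices \<Lambda>"
    using deg_rng[of v] by (simp add: paths_deg_def)
qed

text \<open>The set \<open>vS\<close> for \<open>S \<subseteq> \<Lambda>\<close>.\<close>

definition into :: "('a, 'k) kgraph_data \<Rightarrow> 'a \<Rightarrow> 'a set \<Rightarrow> 'a set" where
  "into \<Lambda> v S = {l \<in> S. rng \<Lambda> l = v}"

definition row_finite :: "('a, 'k) kgraph_data \<Rightarrow> bool" where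
  "row_finite \<Lambda> \<longleftrightarrow> (\<forall>v \<in> vertices \<Lambda>. \<forall>n. finite (into \<Lambda> v (paths_deg \<Lambda> n)))"

definition locally_convex :: "('a, 'k) kgraph_data \<Rightarrow> bool" where
  "locally_convex \<Lambda> \<longleftrightarrow>
    (\<forall>i j. \<forall>e \<in> paths_deg \<Lambda> (gen i). j \<noteq> i \<longrightarrow>
      into \<Lambda> (src \<Lambda> e) (paths_deg \<Lambda> (gen j)) = {} \<longrightarrow>
      into \<Lambda> (rng \<Lambda> e) (paths_deg \<Lambda> (gen j)) = {})"

text \<open>The set \<open>\<Lambda>\<^sup>\<le>\<^sup>n\<close>.\<close>

definition paths_le :: "('a, 'k) kgraph_data \<Rightarrow> ('k \<Rightarrow> nat) \<Rightarrow> 'a set" where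
  "paths_le \<Lambda> n = {l \<in> paths \<Lambda>. deg \<Lambda> l \<le> n \<and>
    (\<forall>\<mu> \<in> into \<Lambda> (src \<Lambda> l) (paths \<Lambda>). deg \<Lambda> (cmp \<Lambda> l \<mu>) \<le> n \<longrightarrow> \<mu> = src \<Lambda> l)}"

lemma finite_into_paths_le:
  fixes \<Lambda> :: "('a, 'k::finite) kgraph_data"
  assumes "row_finite \<Lambda>" "v \<in> vertices \<Lambda>"
  shows "finite (into \<Lambda> v (paths_le \<Lambda> n))"
proof (rule finite_subset)
  show "into \<Lambda> v (paths_le \<Lambda> n) \<subseteq> (\<Union>m \<in> {..n}. into \<Lambda> v (paths_deg \<Lambda> m))"
    by (auto simp: into_def paths_le_def paths_deg_def)
  have "{..n} \<subseteq> (UNIV :: 'k set) \<rightarrow>\<^sub>E {..Max (range n)}"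
  proof
    fix m assume "m \<in> {..n}"
    then have "m i \<le> n i" for i by (simp add: le_fun_def)
    moreover have "n i \<le> Max (range n)" for i by (rule Max_ge) auto
    ultimately have "m i \<le> Max (range n)" for i by (rule le_trans)
    then show "m \<in> UNIV \<rightarrow>\<^sub>E {..Max (range n)}" by auto
  qed
  then have "finite {..n}"
    by (rule finite_subset) (simp add: finite_PiE)
  then show "finite (\<Union>m \<in> {..n}. into \<Lambda> v (paths_deg \<Lambda> m))"
    using assms by (simp add: row_finite_def)
qed

text \<open>
  A function on \<open>\<Lambda>\<^sup>0\<close> is an extensional function (so that functions are equal as soon as they
  agree on \<open>\<Lambda>\<^sup>0\<close>). Only row-finite \<open>\<Lambda>\<close> are of interest, so the sum is finite by
  \<open>finite_into_paths_le\<close>.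
\<close>

definition kgraph_trace :: "('a, 'k) kgraph_data \<Rightarrow> ('a \<Rightarrow> real) \<Rightarrow> bool" where
  "kgraph_trace \<Lambda> g \<longleftrightarrow> g \<in> vertices \<Lambda> \<rightarrow>\<^sub>E {0..} \<and>
    (\<forall>v \<in> vertices \<Lambda>. \<forall>n. g v = (\<Sum>l \<in> into \<Lambda> v (paths_le \<Lambda> n). g (src \<Lambda> l)))"

definition Omega :: "('k \<Rightarrow> enat) \<Rightarrow> (('k \<Rightarrow> nat) \<times> ('k \<Rightarrow> nat), 'k) kgraph_data" where
  "Omega m = \<lparr>
    paths = {(p, q). p \<le> q \<and> le_enat q m},
    rng = (\<lambda>(p, q). (p, p)),
    src = (\<lambda>(p, q). (q, q)),
    cmp = (\<lambda>(p, q) (q', n). (p, n)),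
    deg = (\<lambda>(p, q). q - p)\<rparr>"

lemma le_enat_mono: "p \<le> q \<Longrightarrow> le_enat q m \<Longrightarrow> le_enat p m"
  unfolding le_enat_def le_fun_def by (meson enat_ord_simps(1) order_trans)

lemma k_graph_Omega: "k_graph (Omega (m :: 'k::finite \<Rightarrow> enat))"
proof
  show "countable (paths (Omega m))"
    by (rule countableI_type)
next
  fix l :: "('k \<Rightarrow> nat) \<times> ('k \<Rightarrow> nat)" and a b :: "'k \<Rightarrow> nat"
  assume l: "l \<in> paths (Omega m)" and d: "deg (Omega m) l = a + b"
  obtain p q where pq: "l = (p, q)" "p \<le> q" "le_enat q m"
    using l by (auto simp: Omega_def)
  have q: "q = p + a + b"
  proof
    fix i
    have "q i - p i = a i + b i" "p i \<le> q i"
      using d pq by (auto simp: Omega_def le_fun_def fun_eq_iff)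
    then show "q i = (p + a + b) i" by simp
  qed
  have 1: "p + a \<le> q" by (simp add: q le_fun_def)
  have 2: "le_enat (p + a) m" using 1 pq(3) by (rule le_enat_mono)
  have 3: "p \<le> p + a" "p + a - p = a" "q - (p + a) = b"
    by (simp_all add: q le_fun_def fun_eq_iff)
  have 4: "u = p + a" if "p \<le> u" "u - p = a" for u
  proof
    fix i
    have "p i \<le> u i" "u i - p i = a i"
      using that by (auto simp: le_fun_def)
    then show "u i = (p + a) i" by simp
  qed
  show "\<exists>!(\<mu>, \<nu>). \<mu> \<in> paths (Omega m) \<and> \<nu> \<in> paths (Omega m) \<and>
    src (Omega m) \<mu> = rng (Omega m) \<nu> \<and>
    deg (Omega m) \<mu> = a \<and> deg (Omega m) \<nu> = b \<and> l = cmp (Omega m) \<mu> \<nu>"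
    by (rule ex1I[of _ "((p, p + a), (p + a, q))"])
      (use pq 1 2 3 in \<open>auto simp: Omega_def dest: 4\<close>)
qed (auto simp: Omega_def fun_eq_iff le_fun_def elim!: le_enat_mono[unfolded le_fun_def, rotated],
    meson le_trans)

definition degree_functor ::
  "('a, 'k) kgraph_data \<Rightarrow> ('b, 'k) kgraph_data \<Rightarrow> ('a \<Rightarrow> 'b) \<Rightarrow> bool" where
  "degree_functor \<Gamma> \<Lambda> F \<longleftrightarrow>
    F \<in> paths \<Gamma> \<rightarrow>\<^sub>E paths \<Lambda> \<and>
    (\<forall>l \<in> paths \<Gamma>. F (rng \<Gamma> l) = rng \<Lambda> (F l) \<and> F (src \<Gamma> l) = src \<Lambda> (F l) \<and>
      deg \<Lambda> (F l) = deg \<Gamma> l) \<and>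
    (\<forall>\<mu> \<in> paths \<Gamma>. \<forall>\<nu> \<in> paths \<Gamma>. src \<Gamma> \<mu> = rng \<Gamma> \<nu> \<longrightarrow>
      F (cmp \<Gamma> \<mu> \<nu>) = cmp \<Lambda> (F \<mu>) (F \<nu>))"

text \<open>
  A boundary path \<open>x : \<Omega>\<^sub>k\<^sub>,\<^sub>m \<rightarrow> \<Lambda>\<close> is stored with its degree, as the pair \<open>(m, x)\<close>.
\<close>

type_synonym ('a, 'k) bpath = "('k \<Rightarrow> enat) \<times> (('k \<Rightarrow> nat) \<times> ('k \<Rightarrow> nat) \<Rightarrow> 'a)"

abbreviation bdeg :: "('a, 'k) bpath \<Rightarrow> 'k \<Rightarrow> enat" where
  "bdeg x \<equiv> fst x"

abbreviation seg :: "('a, 'k) bpath \<Rightarrow> ('k \<Rightarrow> nat) \<Rightarrow> ('k \<Rightarrow> nat) \<Rightarrow> 'a" where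
  "seg x p q \<equiv> snd x (p, q)"

abbreviation vertex_at :: "('a, 'k) bpath \<Rightarrow> ('k \<Rightarrow> nat) \<Rightarrow> 'a" where
  "vertex_at x n \<equiv> seg x n n"

definition boundary_path :: "('a, 'k) kgraph_data \<Rightarrow> ('a, 'k) bpath \<Rightarrow> bool" where
  "boundary_path \<Lambda> x \<longleftrightarrow>
    degree_functor (Omega (bdeg x)) \<Lambda> (snd x) \<and>
    (\<forall>i n. bdeg x i < \<infinity> \<longrightarrow> le_enat n (bdeg x) \<longrightarrow> enat (n i) = bdeg x i \<longrightarrow>
      into \<Lambda> (vertex_at x n) (paths_deg \<Lambda> (gen i)) = {})"

definition Ends :: "('a, 'k) kgraph_data \<Rightarrow> ('a, 'k) bpath set" where
  "Ends \<Lambda> = {x. boundary_path \<Lambda> x \<and>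
    (\<forall>n. le_enat n (bdeg x) \<longrightarrow> into \<Lambda> (vertex_at x 0) (paths_deg \<Lambda> n) = {seg x 0 n})}"

definition end_rel :: "('a, 'k) kgraph_data \<Rightarrow> (('a, 'k) bpath \<times> ('a, 'k) bpath) set" where
  "end_rel \<Lambda> = {(x, y). x \<in> Ends \<Lambda> \<and> y \<in> Ends \<Lambda> \<and>
    (\<exists>n m. le_enat n (bdeg x) \<and> le_enat m (bdeg y) \<and> vertex_at x n = vertex_at y m)}"

abbreviation end_class :: "('a, 'k) kgraph_data \<Rightarrow> ('a, 'k) bpath \<Rightarrow> ('a, 'k) bpath set" where
  "end_class \<Lambda> x \<equiv> end_rel \<Lambda> `` {x}"

definition lies_on :: "'a \<Rightarrow> ('a, 'k) bpath \<Rightarrow> bool" where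
  "lies_on v x \<longleftrightarrow> (\<exists>n. le_enat n (bdeg x) \<and> v = vertex_at x n)"

text \<open>
  The boundary path \<open>x\<^sub>v\<close>; meaningful only when \<open>v\<close> lies on an end, in which case there is exactly
  one boundary path with range \<open>v\<close>.
\<close>

definition path_from :: "('a, 'k) kgraph_data \<Rightarrow> 'a \<Rightarrow> ('a, 'k) bpath" where
  "path_from \<Lambda> v = (THE x. boundary_path \<Lambda> x \<and> vertex_at x 0 = v)"

end

theory Submission
  imports Defs
begin

text \<open>
  From a vertex \<open>w\<close> on an end one can only follow that end: its remainder is the unique boundary path
  from \<open>w\<close> (\<open>Ends_unique\<close>), and \<open>w\<Lambda>\<^sup>\<le>\<^sup>n\<close> has exactly one element, whose source again lies on the end
  (\<open>Ends_paths_le\<close>). A trace is therefore constant along an end and, because ends that meet agree from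
  there on, constant on classes of ends. The trace equation at \<open>v\<close> for the level \<open>n\<^sub>v\<close> involves only
  sources lying on ends; this is part (a), and also uniqueness in part (b).

  For existence, that same equation has to serve as the definition, and the question is why the
  result satisfies the trace equation at every other level. The answer is that
  \<open>\<Lambda>\<^sup>\<le>\<^sup>n\<^sup>+\<^sup>m = \<Lambda>\<^sup>\<le>\<^sup>n\<Lambda>\<^sup>\<le>\<^sup>m\<close> with unique factorisation (\<open>bij_betw_paths_le_add\<close>), which is where local
  convexity is used. It shows first that the defining sum may be taken at any level \<open>n \<ge> n\<^sub>v\<close>
  (\<open>end_sum_stable\<close>), since beyond \<open>n\<^sub>v\<close> paths merely continue along ends. By row-finiteness, one level
  is high enough for all the finitely many vertices in a given trace equation at once, and the
  equation becomes the factorisation of a sum over one high level (\<open>end_sum_trace\<close>).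
\<close>

section \<open>Factorisations and maximal paths of bounded degree\<close>

text \<open>
  Being blocked in direction \<open>i\<close> turns the maximality clause in \<open>\<Lambda>\<^sup>\<le>\<^sup>n\<close> into a condition on each
  coordinate separately. It passes from the range of any path to its source; local convexity gives the
  reverse for paths that do not move in direction \<open>i\<close>.
\<close>

definition blocked :: "('a, 'k) kgraph_data \<Rightarrow> 'k \<Rightarrow> 'a \<Rightarrow> bool" where
  "blocked \<Lambda> i v \<longleftrightarrow> into \<Lambda> v (paths_deg \<Lambda> (gen i)) = {}"

lemma gen_add_diff:
  assumes "0 < d i"
  shows "gen i + (d - gen i) = d"
  using assms by (auto simp: gen_def fun_eq_iff)

context k_graph
begin

lemma factorE:
  assumes "l \<in> paths \<Lambda>" "deg \<Lambda> l = m + n"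
  obtains \<mu> \<nu> where "\<mu> \<in> paths \<Lambda>" "\<nu> \<in> paths \<Lambda>" "src \<Lambda> \<mu> = rng \<Lambda> \<nu>"
    "deg \<Lambda> \<mu> = m" "deg \<Lambda> \<nu> = n" "l = cmp \<Lambda> \<mu> \<nu>"
  using ex1_implies_ex[OF factorisation[OF assms]] by auto

lemma factor_unique:
  assumes "\<mu> \<in> paths \<Lambda>" "\<nu> \<in> paths \<Lambda>" "src \<Lambda> \<mu> = rng \<Lambda> \<nu>"
    and "\<mu>' \<in> paths \<Lambda>" "\<nu>' \<in> paths \<Lambda>" "src \<Lambda> \<mu>' = rng \<Lambda> \<nu>'"
    and "deg \<Lambda> \<mu> = deg \<Lambda> \<mu>'" "cmp \<Lambda> \<mu> \<nu> = cmp \<Lambda> \<mu>' \<nu>'"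
  shows "\<mu> = \<mu>' \<and> \<nu> = \<nu>'"
proof -
  have "deg \<Lambda> \<mu> + deg \<Lambda> \<nu> = deg \<Lambda> \<mu>' + deg \<Lambda> \<nu>'"
    using assms deg_cmp by metis
  then have "deg \<Lambda> \<nu> = deg \<Lambda> \<nu>'"
    using assms(7) by (simp add: fun_eq_iff)
  let ?l = "cmp \<Lambda> \<mu> \<nu>"
  let ?P = "\<lambda>(\<alpha>, \<beta>). \<alpha> \<in> paths \<Lambda> \<and> \<beta> \<in> paths \<Lambda> \<and> src \<Lambda> \<alpha> = rng \<Lambda> \<beta> \<and>
        deg \<Lambda> \<alpha> = deg \<Lambda> \<mu> \<and> deg \<Lambda> \<beta> = deg \<Lambda> \<nu> \<and> ?l = cmp \<Lambda> \<alpha> \<beta>"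
  have "\<exists>!z. ?P z"
    using factorisation[OF cmp_closed deg_cmp] assms by blast
  moreover have "?P (\<mu>, \<nu>)" "?P (\<mu>', \<nu>')"
    using assms \<open>deg \<Lambda> \<nu> = deg \<Lambda> \<nu>'\<close> by auto
  ultimately have "(\<mu>, \<nu>) = (\<mu>', \<nu>')" by blast
  then show ?thesis by simp
qed

lemma src_vertex: "l \<in> paths \<Lambda> \<Longrightarrow> src \<Lambda> l \<in> vertices \<Lambda>"
  by (simp add: paths_deg_def src_closed deg_src)

lemma deg_0_rng_src:
  assumes "l \<in> paths \<Lambda>" "deg \<Lambda> l = 0"
  shows "rng \<Lambda> l = l" "src \<Lambda> l = l"
proof -
  show "rng \<Lambda> l = l"
    using vertices_eq_identities assms by (auto simp: paths_deg_def)
  then show "src \<Lambda> l = l"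
    using src_rng[OF assms(1)] by simp
qed

lemma deg_of_blocked_rng:
  assumes "l \<in> paths \<Lambda>" "blocked \<Lambda> i (rng \<Lambda> l)"
  shows "deg \<Lambda> l i = 0"
proof (rule ccontr)
  assume "deg \<Lambda> l i \<noteq> 0"
  then have "deg \<Lambda> l = gen i + (deg \<Lambda> l - gen i)"
    by (simp add: gen_add_diff)
  then obtain \<mu> \<nu> where \<mu>: "\<mu> \<in> paths \<Lambda>" "\<nu> \<in> paths \<Lambda>" "src \<Lambda> \<mu> = rng \<Lambda> \<nu>"
    "deg \<Lambda> \<mu> = gen i" "l = cmp \<Lambda> \<mu> \<nu>"
    using factorE[OF assms(1)] by metis
  then have "\<mu> \<in> into \<Lambda> (rng \<Lambda> l) (paths_deg \<Lambda> (gen i))"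
    by (simp add: into_def paths_deg_def rng_cmp)
  then show False
    using assms(2) by (simp add: blocked_def)
qed

lemma blocked_src:
  assumes "l \<in> paths \<Lambda>" "blocked \<Lambda> i (rng \<Lambda> l)"
  shows "blocked \<Lambda> i (src \<Lambda> l)"
proof (rule ccontr)
  assume "\<not> blocked \<Lambda> i (src \<Lambda> l)"
  then obtain e where e: "e \<in> paths \<Lambda>" "deg \<Lambda> e = gen i" "src \<Lambda> l = rng \<Lambda> e"
    by (auto simp: blocked_def into_def paths_deg_def)
  have "deg \<Lambda> (cmp \<Lambda> l e) i = 0"
    using assms e by (intro deg_of_blocked_rng) (auto simp: cmp_closed rng_cmp)
  then show False
    using assms e by (simp add: deg_cmp gen_def)
qed

text \<open>
  Local convexity is stated for single edges; peeling edges off the range end of a path, by induction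
  on its length, extends it to all paths not moving in direction \<open>i\<close>.
\<close>

lemma blocked_rng:
  assumes "locally_convex \<Lambda>" "l \<in> paths \<Lambda>" "deg \<Lambda> l i = 0" "blocked \<Lambda> i (src \<Lambda> l)"
  shows "blocked \<Lambda> i (rng \<Lambda> l)"
  using assms(2-)
proof (induction "sum (deg \<Lambda> l) UNIV" arbitrary: l rule: less_induct)
  case less
  show ?case
  proof (cases "deg \<Lambda> l = 0")
    case True
    then show ?thesis using deg_0_rng_src less.prems by metis
  next
    case False
    then obtain j where j: "0 < deg \<Lambda> l j" by (auto simp: fun_eq_iff)
    then have "i \<noteq> j" using less.prems by auto
    obtain e \<mu> where e: "e \<in> paths \<Lambda>" "\<mu> \<in> paths \<Lambda>" "src \<Lambda> e = rng \<Lambda> \<mu>"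
      "deg \<Lambda> e = gen j" "deg \<Lambda> \<mu> = deg \<Lambda> l - gen j" "l = cmp \<Lambda> e \<mu>"
      using factorE[OF less.prems(1) gen_add_diff[of "deg \<Lambda> l" j, OF j, symmetric]] by metis
    have "sum (deg \<Lambda> \<mu>) UNIV < sum (deg \<Lambda> l) UNIV"
      by (rule sum_strict_mono_ex1) (use j e(5) in \<open>auto simp: gen_def intro!: exI[of _ j]\<close>)
    moreover have "deg \<Lambda> \<mu> i = 0" using e(5) less.prems(2) by simp
    moreover have "blocked \<Lambda> i (src \<Lambda> \<mu>)" using e less.prems by (simp add: src_cmp)
    ultimately have "blocked \<Lambda> i (rng \<Lambda> \<mu>)" using less.hyps e(2) by blast
    then have "blocked \<Lambda> i (rng \<Lambda> e)"
      using assms(1) e(1,3,4) \<open>i \<noteq> j\<close>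
      unfolding locally_convex_def blocked_def paths_deg_def by auto
    then show ?thesis using e by (simp add: rng_cmp)
  qed
qed

lemma paths_le_iff:
  "l \<in> paths_le \<Lambda> n \<longleftrightarrow>
    l \<in> paths \<Lambda> \<and> deg \<Lambda> l \<le> n \<and> (\<forall>i. deg \<Lambda> l i < n i \<longrightarrow> blocked \<Lambda> i (src \<Lambda> l))"
proof (cases "l \<in> paths \<Lambda> \<and> deg \<Lambda> l \<le> n")
  case True
  have "blocked \<Lambda> i (src \<Lambda> l)" if l: "l \<in> paths_le \<Lambda> n" and i: "deg \<Lambda> l i < n i" for i
  proof (rule ccontr)
    assume "\<not> blocked \<Lambda> i (src \<Lambda> l)"
    then obtain e where e: "e \<in> paths \<Lambda>" "deg \<Lambda> e = gen i" "src \<Lambda> l = rng \<Lambda> e"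
      by (auto simp: blocked_def into_def paths_deg_def)
    have "deg \<Lambda> (cmp \<Lambda> l e) \<le> n"
      using True e i by (auto simp: deg_cmp le_fun_def gen_def)
    then have "e = src \<Lambda> l"
      using l e by (auto simp: paths_le_def into_def)
    then have "gen i = 0" using e True deg_src by metis
    then show False by (auto simp: gen_def fun_eq_iff split: if_splits)
  qed
  moreover have "\<mu> = src \<Lambda> l"
    if b: "\<forall>i. deg \<Lambda> l i < n i \<longrightarrow> blocked \<Lambda> i (src \<Lambda> l)"
      and \<mu>: "\<mu> \<in> paths \<Lambda>" "rng \<Lambda> \<mu> = src \<Lambda> l" "deg \<Lambda> (cmp \<Lambda> l \<mu>) \<le> n" for \<mu>
  proof -
    have d: "deg \<Lambda> l i + deg \<Lambda> \<mu> i \<le> n i" for i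
      using \<mu> True by (simp add: deg_cmp le_fun_def)
    have "deg \<Lambda> \<mu> i = 0" for i
    proof (cases "deg \<Lambda> l i < n i")
      case True
      then show ?thesis using b \<mu> deg_of_blocked_rng by simp
    next
      case False
      then show ?thesis using d[of i] by simp
    qed
    then have "deg \<Lambda> \<mu> = 0" by (simp add: fun_eq_iff)
    then show ?thesis using \<mu> deg_0_rng_src by metis
  qed
  ultimately show ?thesis
    using True by (auto simp: paths_le_def into_def)
qed (auto simp: paths_le_def)

text \<open>
  If \<open>\<nu> = \<lambda>\<mu>\<close> with \<open>\<lambda> \<in> \<Lambda>\<^sup>\<le>\<^sup>n\<close>, then in every coordinate where \<open>\<lambda>\<close> falls short of \<open>n\<close> it is blocked, so \<open>\<mu>\<close>
  does not move there. Hence \<open>\<nu>\<close> determines \<open>d(\<lambda>) = min d(\<nu>) n\<close>, and with it the factorisation.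
\<close>

lemma deg_paths_le_prefix:
  assumes "l \<in> paths_le \<Lambda> n" "\<mu> \<in> paths \<Lambda>" "src \<Lambda> l = rng \<Lambda> \<mu>"
  shows "deg \<Lambda> l i = min (deg \<Lambda> (cmp \<Lambda> l \<mu>) i) (n i)"
proof -
  have l: "l \<in> paths \<Lambda>" "deg \<Lambda> l i \<le> n i"
    using assms(1) by (auto simp: paths_le_iff le_fun_def)
  have "deg \<Lambda> \<mu> i = 0" if "deg \<Lambda> l i < n i"
    using that assms deg_of_blocked_rng by (auto simp: paths_le_iff)
  then show ?thesis using l assms by (cases "deg \<Lambda> l i < n i") (auto simp: deg_cmp)
qed

text \<open>
  Existence of the factorisation is where local convexity enters: the factor of
  \<open>\<nu> \<in> \<Lambda>\<^sup>\<le>\<^sup>n\<^sup>+\<^sup>m\<close> of degree \<open>min d(\<nu>) n\<close> at the range end must be maximal below \<open>n\<close>. In a coordinate where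
  it falls short, \<open>\<nu>\<close> is blocked at its source and the other factor does not move, so the block can
  be carried back along that factor.
\<close>

lemma bij_betw_paths_le_add:
  assumes "locally_convex \<Lambda>"
  shows "bij_betw (\<lambda>(l, \<mu>). cmp \<Lambda> l \<mu>)
    (SIGMA l : into \<Lambda> v (paths_le \<Lambda> n). into \<Lambda> (src \<Lambda> l) (paths_le \<Lambda> m))
    (into \<Lambda> v (paths_le \<Lambda> (n + m)))"
  unfolding bij_betw_def
proof
  show "inj_on (\<lambda>(l, \<mu>). cmp \<Lambda> l \<mu>)
    (SIGMA l : into \<Lambda> v (paths_le \<Lambda> n). into \<Lambda> (src \<Lambda> l) (paths_le \<Lambda> m))"
  proof (rule inj_onI, clarify)
    fix l \<mu> l' \<mu>'
    assume l: "l \<in> into \<Lambda> v (paths_le \<Lambda> n)" "\<mu> \<in> into \<Lambda> (src \<Lambda> l) (paths_le \<Lambda> m)"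
      and l': "l' \<in> into \<Lambda> v (paths_le \<Lambda> n)" "\<mu>' \<in> into \<Lambda> (src \<Lambda> l') (paths_le \<Lambda> m)"
      and eq: "cmp \<Lambda> l \<mu> = cmp \<Lambda> l' \<mu>'"
    have p: "l \<in> paths_le \<Lambda> n" "l' \<in> paths_le \<Lambda> n" "\<mu> \<in> paths \<Lambda>" "\<mu>' \<in> paths \<Lambda>"
      "src \<Lambda> l = rng \<Lambda> \<mu>" "src \<Lambda> l' = rng \<Lambda> \<mu>'"
      using l l' by (auto simp: into_def paths_le_def)
    have "deg \<Lambda> l = deg \<Lambda> l'"
    proof
      fix i
      show "deg \<Lambda> l i = deg \<Lambda> l' i"
        using deg_paths_le_prefix[OF p(1,3,5), of i] deg_paths_le_prefix[OF p(2,4,6), of i] eq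
        by simp
    qed
    then show "l = l' \<and> \<mu> = \<mu>'"
      using factor_unique p eq by (auto simp: paths_le_iff)
  qed
  show "(\<lambda>(l, \<mu>). cmp \<Lambda> l \<mu>) `
    (SIGMA l : into \<Lambda> v (paths_le \<Lambda> n). into \<Lambda> (src \<Lambda> l) (paths_le \<Lambda> m)) =
    into \<Lambda> v (paths_le \<Lambda> (n + m))" (is "?f ` ?S = ?T")
  proof
    show "?f ` ?S \<subseteq> ?T"
    proof clarify
      fix l \<mu>
      assume l: "l \<in> into \<Lambda> v (paths_le \<Lambda> n)" "\<mu> \<in> into \<Lambda> (src \<Lambda> l) (paths_le \<Lambda> m)"
      have p: "l \<in> paths_le \<Lambda> n" "rng \<Lambda> l = v" "\<mu> \<in> paths_le \<Lambda> m" "src \<Lambda> l = rng \<Lambda> \<mu>"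
        "l \<in> paths \<Lambda>" "\<mu> \<in> paths \<Lambda>"
        using l by (auto simp: into_def paths_le_def)
      have "deg \<Lambda> l i \<le> n i" "deg \<Lambda> \<mu> i \<le> m i" for i
        using p by (auto simp: paths_le_iff le_fun_def)
      then have d: "deg \<Lambda> (cmp \<Lambda> l \<mu>) \<le> n + m"
        using p by (auto simp: deg_cmp le_fun_def intro: add_mono)
      have "blocked \<Lambda> i (src \<Lambda> \<mu>)" if "deg \<Lambda> (cmp \<Lambda> l \<mu>) i < (n + m) i" for i
      proof (cases "deg \<Lambda> \<mu> i < m i")
        case True
        then show ?thesis using p by (simp add: paths_le_iff)
      next
        case False
        then have "deg \<Lambda> l i < n i" using that p by (simp add: deg_cmp)
        then show ?thesis using p blocked_src by (simp add: paths_le_iff)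
      qed
      then show "cmp \<Lambda> l \<mu> \<in> ?T"
        using p d by (simp add: into_def paths_le_iff cmp_closed rng_cmp src_cmp)
    qed
    show "?T \<subseteq> ?f ` ?S"
    proof
      fix \<nu> assume "\<nu> \<in> ?T"
      then have \<nu>: "\<nu> \<in> paths \<Lambda>" "rng \<Lambda> \<nu> = v" "\<And>i. deg \<Lambda> \<nu> i \<le> n i + m i"
        "\<And>i. deg \<Lambda> \<nu> i < n i + m i \<Longrightarrow> blocked \<Lambda> i (src \<Lambda> \<nu>)"
        by (auto simp: into_def paths_le_iff le_fun_def)
      define a where "a = (\<lambda>i. min (deg \<Lambda> \<nu> i) (n i))"
      have "deg \<Lambda> \<nu> = a + (deg \<Lambda> \<nu> - a)" by (simp add: a_def fun_eq_iff)
      then obtain l \<mu> where l: "l \<in> paths \<Lambda>" "\<mu> \<in> paths \<Lambda>" "src \<Lambda> l = rng \<Lambda> \<mu>"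
        "deg \<Lambda> l = a" "deg \<Lambda> \<mu> = deg \<Lambda> \<nu> - a" "\<nu> = cmp \<Lambda> l \<mu>"
        using factorE[OF \<nu>(1)] by metis
      have s: "src \<Lambda> \<nu> = src \<Lambda> \<mu>" using l src_cmp by simp
      have "l \<in> paths_le \<Lambda> n"
        unfolding paths_le_iff
      proof (intro conjI allI impI)
        show "l \<in> paths \<Lambda>" by fact
        show "deg \<Lambda> l \<le> n" using l by (simp add: a_def le_fun_def)
        fix i assume "deg \<Lambda> l i < n i"
        then have i: "deg \<Lambda> \<nu> i < n i" "deg \<Lambda> \<mu> i = 0" unfolding l a_def by auto
        then have "blocked \<Lambda> i (src \<Lambda> \<mu>)" using \<nu>(4)[of i] s by simp
        then show "blocked \<Lambda> i (src \<Lambda> l)" using blocked_rng[OF assms l(2) i(2)] l(3) by simp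
      qed
      moreover have "\<mu> \<in> paths_le \<Lambda> m"
        unfolding paths_le_iff
      proof (intro conjI allI impI)
        show "\<mu> \<in> paths \<Lambda>" by fact
        have "deg \<Lambda> \<mu> i \<le> m i" for i using \<nu>(3)[of i] unfolding l(5) a_def by auto
        then show "deg \<Lambda> \<mu> \<le> m" by (simp add: le_fun_def)
        fix i assume "deg \<Lambda> \<mu> i < m i"
        then have "deg \<Lambda> \<nu> i < n i + m i" unfolding l(5) a_def by auto
        then show "blocked \<Lambda> i (src \<Lambda> \<mu>)" using \<nu>(4) s by simp
      qed
      moreover have "rng \<Lambda> l = v" using l \<nu>(2) by (simp add: rng_cmp)
      ultimately have "(l, \<mu>) \<in> ?S" using l(3) by (simp add: into_def)
      then show "\<nu> \<in> ?f ` ?S" using l(6) by force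
    qed
  qed
qed

lemma sum_paths_le_add:
  fixes f :: "'a \<Rightarrow> 'b::comm_monoid_add"
  assumes "locally_convex \<Lambda>" "row_finite \<Lambda>" "v \<in> vertices \<Lambda>"
  shows "(\<Sum>\<nu> \<in> into \<Lambda> v (paths_le \<Lambda> (n + m)). f (src \<Lambda> \<nu>)) =
    (\<Sum>l \<in> into \<Lambda> v (paths_le \<Lambda> n). \<Sum>\<mu> \<in> into \<Lambda> (src \<Lambda> l) (paths_le \<Lambda> m). f (src \<Lambda> \<mu>))"
proof -
  let ?A = "into \<Lambda> v (paths_le \<Lambda> n)" and ?B = "\<lambda>l. into \<Lambda> (src \<Lambda> l) (paths_le \<Lambda> m)"
  have "(\<Sum>\<nu> \<in> into \<Lambda> v (paths_le \<Lambda> (n + m)). f (src \<Lambda> \<nu>)) =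
    (\<Sum>(l, \<mu>) \<in> Sigma ?A ?B. f (src \<Lambda> (cmp \<Lambda> l \<mu>)))"
    using sum.reindex_bij_betw[OF bij_betw_paths_le_add[OF assms(1)], of "\<lambda>\<nu>. f (src \<Lambda> \<nu>)"]
    by (simp add: case_prod_beta)
  also have "\<dots> = (\<Sum>(l, \<mu>) \<in> Sigma ?A ?B. f (src \<Lambda> \<mu>))"
    by (rule sum.cong) (auto simp: into_def paths_le_iff src_cmp)
  also have "\<dots> = (\<Sum>l \<in> ?A. \<Sum>\<mu> \<in> ?B l. f (src \<Lambda> \<mu>))"
  proof (rule sum.Sigma[symmetric])
    show "finite ?A" using assms by (intro finite_into_paths_le)
    show "\<forall>l \<in> ?A. finite (?B l)"
    proof
      fix l assume "l \<in> ?A"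
      then have "l \<in> paths \<Lambda>" by (simp add: into_def paths_le_def)
      then show "finite (?B l)" using assms by (intro finite_into_paths_le src_vertex)
    qed
  qed
  finally show ?thesis .
qed

end

section \<open>Boundary paths, shifts and ends\<close>

lemma le_enat_add:
  assumes "le_enat n m" "le_enat p (\<lambda>i. m i - enat (n i))"
  shows "le_enat (n + p) m"
  unfolding le_enat_def
proof
  fix i
  have "enat (n i) \<le> m i" "enat (p i) \<le> m i - enat (n i)"
    using assms by (auto simp: le_enat_def)
  then show "enat ((n + p) i) \<le> m i" by (cases "m i") auto
qed

lemma le_enat_diff:
  assumes "n \<le> p" "le_enat p m"
  shows "le_enat (p - n) (\<lambda>i. m i - enat (n i))"
  unfolding le_enat_def
proof
  fix i
  have "n i \<le> p i" "enat (p i) \<le> m i"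
    using assms by (auto simp: le_enat_def le_fun_def)
  then show "enat ((p - n) i) \<le> m i - enat (n i)" by (cases "m i") auto
qed

lemma le_enat_sup: "le_enat n m \<Longrightarrow> le_enat p m \<Longrightarrow> le_enat (\<lambda>i. max (n i) (p i)) m"
  by (simp add: le_enat_def max_def)

lemma le_enat_0: "le_enat 0 m"
  by (simp add: le_enat_def zero_enat_def[symmetric])

text \<open>The usual \<open>\<sigma>\<^sup>n(x)\<close>. The restriction keeps it extensional, so that two boundary paths are equal once
  their degrees and segments are.\<close>

definition shift :: "('k \<Rightarrow> nat) \<Rightarrow> ('a, 'k) bpath \<Rightarrow> ('a, 'k) bpath" where
  "shift n x = (let m = (\<lambda>i. bdeg x i - enat (n i))
    in (m, \<lambda>z \<in> paths (Omega m). seg x (n + fst z) (n + snd z)))"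

lemma bdeg_shift [simp]: "bdeg (shift n x) = (\<lambda>i. bdeg x i - enat (n i))"
  by (simp add: shift_def Let_def)

lemma seg_shift:
  "p \<le> q \<Longrightarrow> le_enat q (bdeg (shift n x)) \<Longrightarrow> seg (shift n x) p q = seg x (n + p) (n + q)"
  by (simp add: shift_def Let_def Omega_def)

context k_graph
begin

context
  fixes x :: "('a, 'k) bpath" assumes x: "boundary_path \<Lambda> x"
begin

lemma seg_props:
  assumes "p \<le> q" "le_enat q (bdeg x)"
  shows "seg x p q \<in> paths \<Lambda>" "rng \<Lambda> (seg x p q) = vertex_at x p"
    "src \<Lambda> (seg x p q) = vertex_at x q" "deg \<Lambda> (seg x p q) = q - p"
proof -
  have F: "degree_functor (Omega (bdeg x)) \<Lambda> (snd x)"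
    using x by (simp add: boundary_path_def)
  have pq: "(p, q) \<in> paths (Omega (bdeg x))" using assms by (simp add: Omega_def)
  show "seg x p q \<in> paths \<Lambda>"
    using F pq unfolding degree_functor_def by auto
  have "snd x (rng (Omega (bdeg x)) (p, q)) = rng \<Lambda> (snd x (p, q)) \<and>
    snd x (src (Omega (bdeg x)) (p, q)) = src \<Lambda> (snd x (p, q)) \<and>
    deg \<Lambda> (snd x (p, q)) = deg (Omega (bdeg x)) (p, q)"
    using F pq unfolding degree_functor_def by blast
  then show "rng \<Lambda> (seg x p q) = vertex_at x p"
    "src \<Lambda> (seg x p q) = vertex_at x q" "deg \<Lambda> (seg x p q) = q - p"
    by (simp_all add: Omega_def)
qed

lemma seg_cmp:
  assumes "p \<le> q" "q \<le> r" "le_enat r (bdeg x)"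
  shows "seg x p r = cmp \<Lambda> (seg x p q) (seg x q r)"
proof -
  have F: "degree_functor (Omega (bdeg x)) \<Lambda> (snd x)"
    using x by (simp add: boundary_path_def)
  have m: "(p, q) \<in> paths (Omega (bdeg x))" "(q, r) \<in> paths (Omega (bdeg x))"
    "src (Omega (bdeg x)) (p, q) = rng (Omega (bdeg x)) (q, r)"
    using assms le_enat_mono by (auto simp: Omega_def)
  have "snd x (cmp (Omega (bdeg x)) (p, q) (q, r)) = cmp \<Lambda> (snd x (p, q)) (snd x (q, r))"
    using F m unfolding degree_functor_def by blast
  then show ?thesis by (simp add: Omega_def)
qed

lemma seg_outside: "\<not> (p \<le> q \<and> le_enat q (bdeg x)) \<Longrightarrow> seg x p q = undefined"
  using x unfolding boundary_path_def degree_functor_def PiE_def extensional_def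
  by (auto simp: Omega_def)

lemma boundary_blocked:
  "le_enat n (bdeg x) \<Longrightarrow> enat (n i) = bdeg x i \<Longrightarrow> blocked \<Lambda> i (vertex_at x n)"
  using x unfolding boundary_path_def blocked_def by (metis enat_ord_simps(4) enat.distinct(1))

lemma boundary_not_blocked:
  assumes "le_enat n (bdeg x)" "enat (n i) \<noteq> bdeg x i"
  shows "le_enat (n + gen i) (bdeg x)" "\<not> blocked \<Lambda> i (vertex_at x n)"
proof -
  have "enat ((n + gen i) j) \<le> bdeg x j" for j
    using assms
    by (cases "bdeg x j"; cases "j = i")
      (auto simp: le_enat_def gen_def Suc_le_eq order.strict_iff_order
        dest: spec[of _ j])
  then show 1: "le_enat (n + gen i) (bdeg x)" by (simp add: le_enat_def)
  have "n \<le> n + gen i" "n + gen i - n = gen i" by (simp_all add: le_fun_def fun_eq_iff)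
  then have "seg x n (n + gen i) \<in> into \<Lambda> (vertex_at x n) (paths_deg \<Lambda> (gen i))"
    using seg_props[OF _ 1] by (simp add: into_def paths_deg_def)
  then show "\<not> blocked \<Lambda> i (vertex_at x n)" by (auto simp: blocked_def)
qed

lemma boundary_path_shift:
  assumes n: "le_enat n (bdeg x)"
  shows "boundary_path \<Lambda> (shift n x)"
proof -
  let ?m = "\<lambda>i. bdeg x i - enat (n i)"
  have le: "n + p \<le> n + q" if "p \<le> q" for p q :: "'k \<Rightarrow> nat"
    using that by (simp add: le_fun_def)
  have b: "le_enat (n + q) (bdeg x)" if "le_enat q ?m" for q
    using le_enat_add[OF n that] .
  have d: "n + q - (n + p) = q - p" for p q :: "'k \<Rightarrow> nat"
    by (simp add: fun_eq_iff)
  have "degree_functor (Omega ?m) \<Lambda> (snd (shift n x))"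
    unfolding degree_functor_def
    by (auto simp: Omega_def shift_def Let_def le b d seg_props le_enat_mono
        intro!: seg_props seg_cmp intro: order_trans)
  moreover have "into \<Lambda> (vertex_at (shift n x) p) (paths_deg \<Lambda> (gen i)) = {}"
    if "?m i < \<infinity>" "le_enat p ?m" "enat (p i) = ?m i" for i p
  proof -
    have "enat ((n + p) i) = bdeg x i"
    proof -
      have "enat (n i) \<le> bdeg x i" using n by (simp add: le_enat_def)
      then show ?thesis using that(3) by (cases "bdeg x i") auto
    qed
    then have "blocked \<Lambda> i (vertex_at x (n + p))"
      using boundary_blocked b[OF that(2)] by blast
    then show ?thesis using that(2) by (simp add: blocked_def seg_shift)
  qed
  ultimately show ?thesis by (simp add: boundary_path_def)
qed

end

lemma Ends_boundary: "x \<in> Ends \<Lambda> \<Longrightarrow> boundary_path \<Lambda> x"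
  by (simp add: Ends_def)

lemma vertex_at_shift_0: "le_enat n (bdeg x) \<Longrightarrow> vertex_at (shift n x) 0 = vertex_at x n"
  by (simp add: seg_shift le_enat_0)

lemma shift_Ends:
  assumes x: "x \<in> Ends \<Lambda>" and n: "le_enat n (bdeg x)"
  shows "shift n x \<in> Ends \<Lambda>"
proof -
  note bx = Ends_boundary[OF x]
  have "into \<Lambda> (vertex_at x n) (paths_deg \<Lambda> p) = {seg x n (n + p)}"
    if p: "le_enat p (bdeg (shift n x))" for p
  proof -
    have np: "le_enat (n + p) (bdeg x)" using le_enat_add[OF n] p by simp
    have le: "n \<le> n + p" "n + p - n = p" "0 \<le> n" by (simp_all add: le_fun_def fun_eq_iff)
    have "seg x n (n + p) \<in> into \<Lambda> (vertex_at x n) (paths_deg \<Lambda> p)"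
      using seg_props[OF bx le(1) np] le by (simp add: into_def paths_deg_def)
    moreover have "l = seg x n (n + p)" if "l \<in> into \<Lambda> (vertex_at x n) (paths_deg \<Lambda> p)" for l
    proof -
      have l: "l \<in> paths \<Lambda>" "rng \<Lambda> l = vertex_at x n" "deg \<Lambda> l = p"
        using that by (auto simp: into_def paths_deg_def)
      note s = seg_props[OF bx le(3) n]
      have "cmp \<Lambda> (seg x 0 n) l \<in> into \<Lambda> (vertex_at x 0) (paths_deg \<Lambda> (n + p))"
        using l s by (simp add: into_def paths_deg_def cmp_closed rng_cmp deg_cmp)
      then have "cmp \<Lambda> (seg x 0 n) l = seg x 0 (n + p)"
        using x np by (simp add: Ends_def)
      then have "cmp \<Lambda> (seg x 0 n) l = cmp \<Lambda> (seg x 0 n) (seg x n (n + p))"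
        using seg_cmp[OF bx le(3,1) np] by simp
      then show ?thesis
        using factor_unique[of "seg x 0 n" l "seg x 0 n" "seg x n (n + p)"] l s
          seg_props[OF bx le(1) np] by simp
    qed
    ultimately show ?thesis by blast
  qed
  then show ?thesis
    using boundary_path_shift[OF bx n] n
    by (simp add: Ends_def vertex_at_shift_0 seg_shift)
qed

text \<open>
  A path from \<open>x(0)\<close> exceeding \<open>d(x)\<close> in coordinate \<open>i\<close> would have the initial segment of degree
  \<open>d(x)\<^sub>i e\<^sub>i\<close> in common with \<open>x\<close>, and \<open>x\<close> is blocked in direction \<open>i\<close> there.
\<close>

lemma Ends_path:
  assumes x: "x \<in> Ends \<Lambda>" and l: "l \<in> paths \<Lambda>" "rng \<Lambda> l = vertex_at x 0"
  shows "le_enat (deg \<Lambda> l) (bdeg x)" "l = seg x 0 (deg \<Lambda> l)"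
proof -
  have eq: "l' = seg x 0 (deg \<Lambda> l')"
    if "l' \<in> paths \<Lambda>" "rng \<Lambda> l' = vertex_at x 0" "le_enat (deg \<Lambda> l') (bdeg x)" for l'
    using x that by (auto simp: Ends_def into_def paths_deg_def)
  show "le_enat (deg \<Lambda> l) (bdeg x)"
    unfolding le_enat_def
  proof (rule ccontr)
    assume "\<not> (\<forall>i. enat (deg \<Lambda> l i) \<le> bdeg x i)"
    then obtain i where i: "bdeg x i < enat (deg \<Lambda> l i)" by (auto simp: not_le)
    then obtain c where c: "bdeg x i = enat c" "c < deg \<Lambda> l i" by (cases "bdeg x i") auto
    define a where "a = (\<lambda>j. if j = i then c else 0)"
    have a: "le_enat a (bdeg x)" "a i = c"
      using c by (auto simp: le_enat_def a_def zero_enat_def[symmetric])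
    have "deg \<Lambda> l = a + (deg \<Lambda> l - a)" using c by (auto simp: a_def fun_eq_iff)
    then obtain \<mu> \<nu> where \<mu>: "\<mu> \<in> paths \<Lambda>" "\<nu> \<in> paths \<Lambda>" "src \<Lambda> \<mu> = rng \<Lambda> \<nu>"
      "deg \<Lambda> \<mu> = a" "deg \<Lambda> \<nu> = deg \<Lambda> l - a" "l = cmp \<Lambda> \<mu> \<nu>"
      using factorE[OF l(1)] by metis
    have "\<mu> = seg x 0 a" using eq[of \<mu>] \<mu> l a by (simp add: rng_cmp)
    then have "src \<Lambda> \<mu> = vertex_at x a"
      using seg_props(3)[OF Ends_boundary[OF x] _ a(1), of 0] by (simp add: le_fun_def)
    then have "blocked \<Lambda> i (rng \<Lambda> \<nu>)"
      using boundary_blocked[OF Ends_boundary[OF x] a(1), of i] a c \<mu>(3) by simp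
    then have "deg \<Lambda> \<nu> i = 0" using \<mu>(2) deg_of_blocked_rng by blast
    then show False using \<mu>(5) a c by simp
  qed
  then show "l = seg x 0 (deg \<Lambda> l)" using eq l by blast
qed

text \<open>
  Every initial segment of a boundary path from \<open>x(0)\<close> is one of \<open>x\<close>, so only the degrees could
  differ. If \<open>d(y)\<^sub>i\<close> were less than \<open>d(x)\<^sub>i\<close>, the boundary condition on \<open>y\<close> would block \<open>x\<close> at
  a vertex where \<open>x\<close> still continues in direction \<open>i\<close>.
\<close>

lemma Ends_unique:
  assumes x: "x \<in> Ends \<Lambda>" and y: "boundary_path \<Lambda> y" "vertex_at y 0 = vertex_at x 0"
  shows "y = x"
proof -
  note bx = Ends_boundary[OF x]
  have ag: "le_enat n (bdeg x) \<and> seg y 0 n = seg x 0 n" if n: "le_enat n (bdeg y)" for n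
  proof -
    have "seg y 0 n \<in> paths \<Lambda>" "rng \<Lambda> (seg y 0 n) = vertex_at x 0" "deg \<Lambda> (seg y 0 n) = n"
      using seg_props[OF y(1) _ n, of 0] y(2) by (simp_all add: le_fun_def)
    then show ?thesis using Ends_path[OF x, of "seg y 0 n"] by simp
  qed
  have vert: "vertex_at y n = vertex_at x n" if n: "le_enat n (bdeg y)" for n
    using seg_props(3)[OF y(1) _ n, of 0] seg_props(3)[OF bx _, of 0 n] ag[OF n]
    by (simp add: le_fun_def)
  have deg_eq: "bdeg y = bdeg x"
  proof
    fix i
    show "bdeg y i = bdeg x i"
    proof (cases "bdeg y i")
      case (enat c)
      define a where "a = (\<lambda>j. if j = i then c else 0)"
      have a: "le_enat a (bdeg y)" "enat (a i) = bdeg y i"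
        using enat by (auto simp: le_enat_def a_def zero_enat_def[symmetric])
      have "blocked \<Lambda> i (vertex_at x a)"
        using boundary_blocked[OF y(1) a] vert[OF a(1)] by simp
      then show ?thesis
        using boundary_not_blocked(2)[OF bx, of a i] ag[OF a(1)] a(2) by metis
    next
      case infinity
      have "enat c \<le> bdeg x i" for c
      proof -
        have "le_enat (\<lambda>j. if j = i then c else 0) (bdeg y)"
          using infinity by (auto simp: le_enat_def zero_enat_def[symmetric])
        then have "le_enat (\<lambda>j. if j = i then c else 0) (bdeg x)" using ag by blast
        then show ?thesis unfolding le_enat_def by (auto dest: spec[of _ i])
      qed
      then have "bdeg x i = \<infinity>"
        by (cases "bdeg x i") (auto, metis not_less_eq_eq order_refl)
      then show ?thesis using infinity by simp
    qed
  qed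
  have "seg y p q = seg x p q" for p q
  proof (cases "p \<le> q \<and> le_enat q (bdeg x)")
    case True
    then have q: "p \<le> q" "le_enat q (bdeg x)" "le_enat q (bdeg y)" "le_enat p (bdeg x)"
      "le_enat p (bdeg y)" "0 \<le> p"
      using deg_eq le_enat_mono by (auto simp: le_fun_def)
    have "cmp \<Lambda> (seg y 0 p) (seg y p q) = cmp \<Lambda> (seg x 0 p) (seg x p q)"
      using seg_cmp[OF y(1) q(6,1,3)] seg_cmp[OF bx q(6,1,2)] ag[OF q(3)] by simp
    then show ?thesis
      using factor_unique[of "seg y 0 p" "seg y p q" "seg x 0 p" "seg x p q"]
        seg_props[OF y(1) q(1,3)] seg_props[OF bx q(1,2)]
        seg_props[OF y(1) q(6,5)] seg_props[OF bx q(6,4)] by simp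
  next
    case False
    then show ?thesis using seg_outside[OF y(1)] seg_outside[OF bx] deg_eq by metis
  qed
  then have "snd y = snd x" by (simp add: fun_eq_iff)
  then show ?thesis using deg_eq by (simp add: prod_eq_iff)
qed

lemma path_from_Ends: "x \<in> Ends \<Lambda> \<Longrightarrow> path_from \<Lambda> (vertex_at x 0) = x"
  unfolding path_from_def using Ends_unique Ends_boundary by (intro the_equality) auto

lemma path_from_vertex_at:
  assumes "x \<in> Ends \<Lambda>" "le_enat n (bdeg x)"
  shows "path_from \<Lambda> (vertex_at x n) = shift n x"
  using path_from_Ends[OF shift_Ends[OF assms]] assms by (simp add: vertex_at_shift_0)

lemma path_from_lies_on:
  assumes "x \<in> Ends \<Lambda>" "lies_on v x"
  shows "path_from \<Lambda> v \<in> Ends \<Lambda>" "vertex_at (path_from \<Lambda> v) 0 = v"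
  using assms by (auto simp: lies_on_def path_from_vertex_at shift_Ends vertex_at_shift_0)

text \<open>
  The one element is \<open>x(0, a)\<close> with \<open>a = min n d(x)\<close>; the last assumption is the form of this
  equation that avoids mixing finite and extended degrees.
\<close>

lemma Ends_paths_le:
  assumes x: "x \<in> Ends \<Lambda>" and a: "a \<le> n" "le_enat a (bdeg x)"
    "\<And>i. a i < n i \<Longrightarrow> enat (a i) = bdeg x i"
  shows "into \<Lambda> (vertex_at x 0) (paths_le \<Lambda> n) = {seg x 0 a}"
proof -
  note bx = Ends_boundary[OF x]
  have "seg x 0 a \<in> into \<Lambda> (vertex_at x 0) (paths_le \<Lambda> n)"
    using seg_props[OF bx _ a(2), of 0] a boundary_blocked[OF bx a(2)]
    by (simp add: into_def paths_le_iff le_fun_def)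
  moreover have "l = seg x 0 a" if "l \<in> into \<Lambda> (vertex_at x 0) (paths_le \<Lambda> n)" for l
  proof -
    have l: "l \<in> paths \<Lambda>" "rng \<Lambda> l = vertex_at x 0" "\<And>i. deg \<Lambda> l i \<le> n i"
      "\<And>i. deg \<Lambda> l i < n i \<Longrightarrow> blocked \<Lambda> i (src \<Lambda> l)"
      using that by (auto simp: into_def paths_le_iff le_fun_def)
    note p = Ends_path[OF x l(1,2)]
    have s: "src \<Lambda> l = vertex_at x (deg \<Lambda> l)"
      using seg_props(3)[OF bx _ p(1), of 0] p(2) by (simp add: le_fun_def)
    have "deg \<Lambda> l i = a i" for i
    proof (cases "deg \<Lambda> l i < n i")
      case True
      then have e: "enat (deg \<Lambda> l i) = bdeg x i"
        using boundary_not_blocked(2)[OF bx p(1)] l(4) s by metis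
      moreover have "enat (a i) \<le> bdeg x i" using a(2) by (simp add: le_enat_def)
      ultimately have "a i \<le> deg \<Lambda> l i" by (metis enat_ord_simps(1))
      then show ?thesis using a(3)[of i] True e by (metis enat.inject order.strict_trans1)
    next
      case False
      then have e: "deg \<Lambda> l i = n i" using l(3)[of i] by simp
      have "enat (deg \<Lambda> l i) \<le> bdeg x i" using p(1) by (simp add: le_enat_def)
      moreover have "a i \<le> n i" using a(1) by (simp add: le_fun_def)
      ultimately show ?thesis
        using a(3)[of i] e by (metis enat_ord_simps(1) le_antisym le_neq_implies_less)
    qed
    then have "deg \<Lambda> l = a" by (simp add: fun_eq_iff)
    then show ?thesis using p(2) by simp
  qed
  ultimately show ?thesis by blast
qed

lemma Ends_paths_le_ex:
  assumes "x \<in> Ends \<Lambda>"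
  obtains a where "le_enat a (bdeg x)" "into \<Lambda> (vertex_at x 0) (paths_le \<Lambda> n) = {seg x 0 a}"
    "src \<Lambda> (seg x 0 a) = vertex_at x a"
proof -
  define a where "a = (\<lambda>i. the_enat (min (enat (n i)) (bdeg x i)))"
  have a: "enat (a i) = min (enat (n i)) (bdeg x i)" for i
    by (cases "bdeg x i") (auto simp: a_def min_def)
  have "a i \<le> n i" for i
    using a[of i] by (metis enat_ord_simps(1) min.cobounded1)
  then have "a \<le> n" by (simp add: le_fun_def)
  moreover have le: "le_enat a (bdeg x)" by (simp add: le_enat_def a)
  moreover have "enat (a i) = bdeg x i" if "a i < n i" for i
    using a[of i] that by (metis enat_ord_simps(2) less_irrefl min_def)
  ultimately have "into \<Lambda> (vertex_at x 0) (paths_le \<Lambda> n) = {seg x 0 a}"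
    using Ends_paths_le[OF assms] by blast
  moreover have "src \<Lambda> (seg x 0 a) = vertex_at x a"
    using seg_props(3)[OF Ends_boundary[OF assms] _ le, of 0] by (simp add: le_fun_def)
  ultimately show ?thesis using that le by blast
qed

text \<open>
  If \<open>x(n) = y(m)\<close>, then \<open>x\<close> and \<open>y\<close> agree from there on, since both shifts are the unique boundary path
  from that vertex. This gives transitivity of \<open>\<sim>\<close>: two vertices of \<open>y\<close> at which it meets \<open>x\<close> and \<open>z\<close> can be replaced
  by one common later vertex.
\<close>

lemma end_rel_forward:
  assumes x: "x \<in> Ends \<Lambda>" and y: "y \<in> Ends \<Lambda>"
    and n: "le_enat n (bdeg x)" and m: "le_enat m (bdeg y)" and eq: "vertex_at x n = vertex_at y m"
    and p: "m \<le> p" "le_enat p (bdeg y)"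
  shows "le_enat (n + (p - m)) (bdeg x)" "vertex_at x (n + (p - m)) = vertex_at y p"
proof -
  have sh: "shift n x = shift m y"
    using path_from_vertex_at[OF x n] path_from_vertex_at[OF y m] eq by simp
  have ly: "le_enat (p - m) (bdeg (shift m y))" using le_enat_diff[OF p] by simp
  then have lx: "le_enat (p - m) (bdeg (shift n x))" using sh by simp
  show "le_enat (n + (p - m)) (bdeg x)" using le_enat_add[OF n] lx by simp
  have "m + (p - m) = p" using p(1) by (simp add: le_fun_def fun_eq_iff)
  then show "vertex_at x (n + (p - m)) = vertex_at y p"
    using seg_shift[OF order_refl lx] seg_shift[OF order_refl ly] sh by simp
qed

lemma equiv_end_rel: "equiv (Ends \<Lambda>) (end_rel \<Lambda>)"
proof (rule equivI)
  show "end_rel \<Lambda> \<subseteq> Ends \<Lambda> \<times> Ends \<Lambda>"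
    by (auto simp: end_rel_def)
  show "refl_on (Ends \<Lambda>) (end_rel \<Lambda>)"
    by (auto simp: refl_on_def end_rel_def intro: le_enat_0)
  show "sym (end_rel \<Lambda>)"
    unfolding sym_def end_rel_def by (auto intro: sym)
  show "trans (end_rel \<Lambda>)"
  proof (rule transI)
    fix x y z assume "(x, y) \<in> end_rel \<Lambda>" "(y, z) \<in> end_rel \<Lambda>"
    then obtain n m m' k where E: "x \<in> Ends \<Lambda>" "y \<in> Ends \<Lambda>" "z \<in> Ends \<Lambda>"
      and l: "le_enat n (bdeg x)" "le_enat m (bdeg y)" "le_enat m' (bdeg y)" "le_enat k (bdeg z)"
      and eq: "vertex_at x n = vertex_at y m" "vertex_at z k = vertex_at y m'"
      by (auto simp: end_rel_def)
    define p where "p = (\<lambda>i. max (m i) (m' i))"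
    have p: "m \<le> p" "m' \<le> p" "le_enat p (bdeg y)"
      using l le_enat_sup by (auto simp: p_def le_fun_def)
    from end_rel_forward[OF E(1,2) l(1,2) eq(1) p(1,3)]
      end_rel_forward[OF E(3,2) l(4,3) eq(2) p(2,3)]
    show "(x, z) \<in> end_rel \<Lambda>" using E by (auto simp: end_rel_def) metis
  qed
qed

end

section \<open>Traces and functions on classes of ends\<close>

context k_graph
begin

lemma rel_path_from:
  assumes "x \<in> Ends \<Lambda>" "lies_on v x"
  shows "(path_from \<Lambda> v, x) \<in> end_rel \<Lambda>"
proof -
  obtain n where n: "le_enat n (bdeg x)" "v = vertex_at x n"
    using assms(2) by (auto simp: lies_on_def)
  then have "vertex_at (path_from \<Lambda> v) 0 = vertex_at x n"
    using path_from_lies_on[OF assms] by simp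
  then show ?thesis
    using path_from_lies_on(1)[OF assms] assms(1) n(1) le_enat_0 unfolding end_rel_def by blast
qed

lemma end_class_path_from:
  assumes "x \<in> Ends \<Lambda>" "lies_on v x"
  shows "end_class \<Lambda> (path_from \<Lambda> v) = end_class \<Lambda> x"
  using equiv_class_eq[OF equiv_end_rel rel_path_from[OF assms]] .

lemma end_class_path_from_in_quotient:
  assumes "x \<in> Ends \<Lambda>" "lies_on v x"
  shows "end_class \<Lambda> (path_from \<Lambda> v) \<in> Ends \<Lambda> // end_rel \<Lambda>"
  using path_from_lies_on(1)[OF assms] by (rule quotientI)

lemma sum_paths_le_end:
  fixes g :: "('a, 'k) bpath set \<Rightarrow> real"
  assumes x: "x \<in> Ends \<Lambda>" and v: "lies_on v x"
  shows "(\<Sum>l \<in> into \<Lambda> v (paths_le \<Lambda> n). g (end_class \<Lambda> (path_from \<Lambda> (src \<Lambda> l)))) =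
    g (end_class \<Lambda> (path_from \<Lambda> v))"
proof -
  define y where "y = path_from \<Lambda> v"
  have y: "y \<in> Ends \<Lambda>" "vertex_at y 0 = v"
    using path_from_lies_on[OF x v] by (auto simp: y_def)
  obtain a where a: "le_enat a (bdeg y)" "into \<Lambda> v (paths_le \<Lambda> n) = {seg y 0 a}"
    "src \<Lambda> (seg y 0 a) = vertex_at y a"
    using Ends_paths_le_ex[OF y(1), of n] y(2) by metis
  have "lies_on (vertex_at y a) y" using a(1) by (auto simp: lies_on_def)
  then have "end_class \<Lambda> (path_from \<Lambda> (vertex_at y a)) = end_class \<Lambda> y"
    by (rule end_class_path_from[OF y(1)])
  then show ?thesis using a by (simp add: y_def)
qed

lemma range_of_end:
  assumes "x \<in> Ends \<Lambda>"
  shows "vertex_at x 0 \<in> vertices \<Lambda>" "lies_on (vertex_at x 0) x"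
proof -
  have "vertex_at x 0 \<in> paths \<Lambda>" "deg \<Lambda> (vertex_at x 0) = 0"
    using seg_props[OF Ends_boundary[OF assms] order_refl le_enat_0] by simp_all
  then show "vertex_at x 0 \<in> vertices \<Lambda>" by (simp add: paths_deg_def)
  show "lies_on (vertex_at x 0) x" by (auto simp: lies_on_def intro: le_enat_0)
qed

lemma trace_along_end:
  assumes g: "kgraph_trace \<Lambda> g" and x: "x \<in> Ends \<Lambda>" and n: "le_enat n (bdeg x)"
  shows "g (vertex_at x n) = g (vertex_at x 0)"
proof -
  note s = seg_props[OF Ends_boundary[OF x] _ n, of 0]
  have "g (vertex_at x 0) = (\<Sum>l \<in> into \<Lambda> (vertex_at x 0) (paths_le \<Lambda> n). g (src \<Lambda> l))"
    using g range_of_end(1)[OF x] unfolding kgraph_trace_def by blast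
  moreover have "into \<Lambda> (vertex_at x 0) (paths_le \<Lambda> n) = {seg x 0 n}"
    by (rule Ends_paths_le[OF x order_refl n]) simp
  moreover have "src \<Lambda> (seg x 0 n) = vertex_at x n" using s by (simp add: le_fun_def)
  ultimately show ?thesis by simp
qed

text \<open>
  The value at \<open>v\<close> that a trace inducing \<open>g\<close> must have by its trace equation at level \<open>n\<close>, provided that
  all sources of \<open>v\<Lambda>\<^sup>\<le>\<^sup>n\<close> lie on ends.
\<close>

definition end_sum :: "(('a, 'k) bpath set \<Rightarrow> real) \<Rightarrow> ('k \<Rightarrow> nat) \<Rightarrow> 'a \<Rightarrow> real" where
  "end_sum g n v =
    (\<Sum>l \<in> into \<Lambda> v (paths_le \<Lambda> n). g (end_class \<Lambda> (path_from \<Lambda> (src \<Lambda> l))))"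

text \<open>
  Paths in \<open>v\<Lambda>\<^sup>\<le>\<^sup>N\<close> extend those in \<open>v\<Lambda>\<^sup>\<le>\<^sup>n\<close>, and each of the latter extends in only one way, along the end on
  which its source lies, without leaving the class of that end.
\<close>

lemma end_sum_stable:
  assumes "locally_convex \<Lambda>" "row_finite \<Lambda>" "v \<in> vertices \<Lambda>"
    and E: "\<forall>l \<in> into \<Lambda> v (paths_le \<Lambda> n). \<exists>x \<in> Ends \<Lambda>. lies_on (src \<Lambda> l) x" and "n \<le> N"
  shows "end_sum g N v = end_sum g n v"
proof -
  have N: "N = n + (N - n)" using \<open>n \<le> N\<close> by (auto simp: le_fun_def fun_eq_iff)
  have "end_sum g N v = (\<Sum>l \<in> into \<Lambda> v (paths_le \<Lambda> n). end_sum g (N - n) (src \<Lambda> l))"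
    unfolding end_sum_def
    by (subst N, rule sum_paths_le_add[OF assms(1-3), of "\<lambda>w. g (end_class \<Lambda> (path_from \<Lambda> w))"])
  also have "\<dots> = end_sum g n v"
    unfolding end_sum_def using E by (intro sum.cong refl) (use sum_paths_le_end in blast)
  finally show ?thesis .
qed

text \<open>
  For given \<open>n\<close>, only finitely many vertices \<open>s(\<mu>)\<close> with \<open>\<mu> \<in> v\<Lambda>\<^sup>\<le>\<^sup>n\<close> occur, so one level \<open>M\<close> dominates
  \<open>n\<^sub>v\<close> and all \<open>n\<^sub>s\<^sub>(\<^sub>\<mu>\<^sub>)\<close>. The trace equation at level \<open>n\<close> is then the factorisation of level \<open>n + M\<close>.
\<close>

lemma end_sum_trace:
  assumes "locally_convex \<Lambda>" "row_finite \<Lambda>"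
    and E: "\<forall>v \<in> vertices \<Lambda>. \<forall>l \<in> into \<Lambda> v (paths_le \<Lambda> (nv v)). \<exists>x \<in> Ends \<Lambda>. lies_on (src \<Lambda> l) x"
    and v: "v \<in> vertices \<Lambda>"
  shows "end_sum g (nv v) v = (\<Sum>\<mu> \<in> into \<Lambda> v (paths_le \<Lambda> n). end_sum g (nv (src \<Lambda> \<mu>)) (src \<Lambda> \<mu>))"
proof -
  let ?A = "into \<Lambda> v (paths_le \<Lambda> n)"
  have fin: "finite ?A" using assms(2) v by (rule finite_into_paths_le)
  define M where "M = (\<lambda>i. nv v i + (\<Sum>\<mu> \<in> ?A. nv (src \<Lambda> \<mu>) i))"
  have "nv v \<le> n + M" by (simp add: M_def le_fun_def)
  then have "end_sum g (nv v) v = end_sum g (n + M) v"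
    using end_sum_stable[OF assms(1,2) v] E v by metis
  also have "\<dots> = (\<Sum>\<mu> \<in> ?A. end_sum g M (src \<Lambda> \<mu>))"
    unfolding end_sum_def
    by (rule sum_paths_le_add[OF assms(1,2) v, of "\<lambda>w. g (end_class \<Lambda> (path_from \<Lambda> w))"])
  also have "\<dots> = (\<Sum>\<mu> \<in> ?A. end_sum g (nv (src \<Lambda> \<mu>)) (src \<Lambda> \<mu>))"
  proof (rule sum.cong)
    fix \<mu> assume \<mu>: "\<mu> \<in> ?A"
    then have s: "src \<Lambda> \<mu> \<in> vertices \<Lambda>"
      by (intro src_vertex) (simp add: into_def paths_le_def)
    have "nv (src \<Lambda> \<mu>) i \<le> (\<Sum>\<mu> \<in> ?A. nv (src \<Lambda> \<mu>) i)" for i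
      using \<mu> fin by (intro member_le_sum) auto
    then have "nv (src \<Lambda> \<mu>) \<le> M" by (simp add: M_def le_fun_def trans_le_add2)
    then show "end_sum g M (src \<Lambda> \<mu>) = end_sum g (nv (src \<Lambda> \<mu>)) (src \<Lambda> \<mu>)"
      using end_sum_stable[OF assms(1,2) s] E s by blast
  qed simp
  finally show ?thesis .
qed

theorem trace_on_end_classes:
  assumes g: "kgraph_trace \<Lambda> g"
    and E: "\<forall>v \<in> vertices \<Lambda>. \<forall>l \<in> into \<Lambda> v (paths_le \<Lambda> (nv v)). \<exists>x \<in> Ends \<Lambda>. lies_on (src \<Lambda> l) x"
  shows "\<exists>h \<in> (Ends \<Lambda> // end_rel \<Lambda>) \<rightarrow>\<^sub>E {0..}.
    (\<forall>x \<in> Ends \<Lambda>. h (end_class \<Lambda> x) = g (vertex_at x 0)) \<and>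
    (\<forall>v \<in> vertices \<Lambda>. g v =
      (\<Sum>l \<in> into \<Lambda> v (paths_le \<Lambda> (nv v)). h (end_class \<Lambda> (path_from \<Lambda> (src \<Lambda> l)))))"
proof -
  define h where "h = (\<lambda>C \<in> Ends \<Lambda> // end_rel \<Lambda>. g (vertex_at (SOME x. x \<in> C) 0))"
  have h: "h (end_class \<Lambda> x) = g (vertex_at x 0)" if x: "x \<in> Ends \<Lambda>" for x
  proof -
    define y where "y = (SOME y. y \<in> end_class \<Lambda> x)"
    have "y \<in> end_class \<Lambda> x"
      unfolding y_def using equiv_class_self[OF equiv_end_rel x] by (rule someI)
    then obtain n m where y: "y \<in> Ends \<Lambda>" "le_enat n (bdeg x)" "le_enat m (bdeg y)"
      "vertex_at x n = vertex_at y m"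
      by (auto simp: end_rel_def)
    then have "g (vertex_at y 0) = g (vertex_at x 0)"
      using trace_along_end[OF g] x by metis
    then show ?thesis using x by (simp add: h_def y_def quotientI)
  qed
  have "h \<in> (Ends \<Lambda> // end_rel \<Lambda>) \<rightarrow>\<^sub>E {0..}"
  proof (rule PiE_I)
    fix C assume "C \<in> Ends \<Lambda> // end_rel \<Lambda>"
    then obtain x where x: "x \<in> Ends \<Lambda>" "C = end_class \<Lambda> x" by (rule quotientE)
    then show "h C \<in> {0..}"
      using h[OF x(1)] range_of_end(1)[OF x(1)] g by (auto simp: kgraph_trace_def)
  qed (simp add: h_def)
  moreover have "g v = (\<Sum>l \<in> into \<Lambda> v (paths_le \<Lambda> (nv v)). h (end_class \<Lambda> (path_from \<Lambda> (src \<Lambda> l))))"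
    if v: "v \<in> vertices \<Lambda>" for v
  proof -
    have "g v = (\<Sum>l \<in> into \<Lambda> v (paths_le \<Lambda> (nv v)). g (src \<Lambda> l))"
      using g v unfolding kgraph_trace_def by blast
    also have "\<dots> = (\<Sum>l \<in> into \<Lambda> v (paths_le \<Lambda> (nv v)). h (end_class \<Lambda> (path_from \<Lambda> (src \<Lambda> l))))"
    proof (rule sum.cong)
      fix l assume "l \<in> into \<Lambda> v (paths_le \<Lambda> (nv v))"
      then obtain x where "x \<in> Ends \<Lambda>" "lies_on (src \<Lambda> l) x" using E v by blast
      from path_from_lies_on[OF this]
      show "g (src \<Lambda> l) = h (end_class \<Lambda> (path_from \<Lambda> (src \<Lambda> l)))" using h by simp
    qed simp
    finally show ?thesis .
  qed
  ultimately show ?thesis using h by blast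
qed

theorem end_classes_trace:
  assumes "locally_convex \<Lambda>" "row_finite \<Lambda>"
    and E: "\<forall>v \<in> vertices \<Lambda>. \<forall>l \<in> into \<Lambda> v (paths_le \<Lambda> (nv v)). \<exists>x \<in> Ends \<Lambda>. lies_on (src \<Lambda> l) x"
    and g: "g \<in> (Ends \<Lambda> // end_rel \<Lambda>) \<rightarrow>\<^sub>E {0 :: real..}"
  shows "\<exists>!gbar. kgraph_trace \<Lambda> gbar \<and>
    (\<forall>x \<in> Ends \<Lambda>. gbar (vertex_at x 0) = g (end_class \<Lambda> x))"
proof (rule ex1I)
  define gbar where "gbar = (\<lambda>v \<in> vertices \<Lambda>. end_sum g (nv v) v)"
  have "gbar v = (\<Sum>l \<in> into \<Lambda> v (paths_le \<Lambda> n). gbar (src \<Lambda> l))" if v: "v \<in> vertices \<Lambda>" for v n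
  proof -
    have "src \<Lambda> l \<in> vertices \<Lambda>" if "l \<in> into \<Lambda> v (paths_le \<Lambda> n)" for l
      using that by (intro src_vertex) (simp add: into_def paths_le_def)
    then show ?thesis
      using end_sum_trace[OF assms(1-2) E v, of g n] v by (simp add: gbar_def)
  qed
  moreover have "0 \<le> end_sum g (nv v) v" if "v \<in> vertices \<Lambda>" for v
    unfolding end_sum_def
  proof (rule sum_nonneg)
    fix l assume "l \<in> into \<Lambda> v (paths_le \<Lambda> (nv v))"
    then obtain x where "x \<in> Ends \<Lambda>" "lies_on (src \<Lambda> l) x" using E \<open>v \<in> vertices \<Lambda>\<close> by blast
    from end_class_path_from_in_quotient[OF this]
    show "0 \<le> g (end_class \<Lambda> (path_from \<Lambda> (src \<Lambda> l)))" using g by (auto dest: PiE_mem)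
  qed
  ultimately have "kgraph_trace \<Lambda> gbar"
    unfolding kgraph_trace_def by (auto simp: gbar_def)
  moreover have "gbar (vertex_at x 0) = g (end_class \<Lambda> x)" if x: "x \<in> Ends \<Lambda>" for x
    using sum_paths_le_end[OF x range_of_end(2)[OF x]] range_of_end(1)[OF x]
    by (simp add: gbar_def end_sum_def path_from_Ends[OF x])
  ultimately show "kgraph_trace \<Lambda> gbar \<and> (\<forall>x \<in> Ends \<Lambda>. gbar (vertex_at x 0) = g (end_class \<Lambda> x))"
    by blast
  fix f assume f: "kgraph_trace \<Lambda> f \<and> (\<forall>x \<in> Ends \<Lambda>. f (vertex_at x 0) = g (end_class \<Lambda> x))"
  show "f = gbar"
  proof
    fix v
    show "f v = gbar v"
    proof (cases "v \<in> vertices \<Lambda>")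
      case True
      have "f v = (\<Sum>l \<in> into \<Lambda> v (paths_le \<Lambda> (nv v)). f (src \<Lambda> l))"
        using f True unfolding kgraph_trace_def by blast
      also have "\<dots> = end_sum g (nv v) v"
        unfolding end_sum_def
      proof (rule sum.cong)
        fix l assume "l \<in> into \<Lambda> v (paths_le \<Lambda> (nv v))"
        then obtain x where "x \<in> Ends \<Lambda>" "lies_on (src \<Lambda> l) x" using E True by blast
        from path_from_lies_on[OF this]
        show "f (src \<Lambda> l) = g (end_class \<Lambda> (path_from \<Lambda> (src \<Lambda> l)))" using f by metis
      qed simp
      finally show ?thesis using True by (simp add: gbar_def)
    next
      case False
      then show ?thesis
        using f unfolding kgraph_trace_def gbar_def by (auto simp: PiE_def extensional_def)
    qed
  qed
qed

end

theorem propositionA3: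
  fixes \<Lambda> :: "('a, 'k::finite) kgraph_data"
    and nv :: "'a \<Rightarrow> 'k \<Rightarrow> nat"
  assumes "k_graph \<Lambda>"
    and "locally_convex \<Lambda>"
    and "row_finite \<Lambda>"
    and "\<forall>v \<in> vertices \<Lambda>. \<forall>l \<in> into \<Lambda> v (paths_le \<Lambda> (nv v)). \<exists>x \<in> Ends \<Lambda>. lies_on (src \<Lambda> l) x"
  shows "(\<forall>g. kgraph_trace \<Lambda> g \<longrightarrow>
      (\<exists>h \<in> (Ends \<Lambda> // end_rel \<Lambda>) \<rightarrow>\<^sub>E {0..}.
        (\<forall>x \<in> Ends \<Lambda>. h (end_class \<Lambda> x) = g (vertex_at x 0)) \<and>
        (\<forall>v \<in> vertices \<Lambda>. g v =
          (\<Sum>l \<in> into \<Lambda> v (paths_le \<Lambda> (nv v)). h (end_class \<Lambda> (path_from \<Lambda> (src \<Lambda> l)))))))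
    \<and> (\<forall>g \<in> (Ends \<Lambda> // end_rel \<Lambda>) \<rightarrow>\<^sub>E {0 :: real..}.
      \<exists>!gbar. kgraph_trace \<Lambda> gbar \<and>
        (\<forall>x \<in> Ends \<Lambda>. gbar (vertex_at x 0) = g (end_class \<Lambda> x)))"
  using k_graph.trace_on_end_classes[OF assms(1) _ assms(4)]
    k_graph.end_classes_trace[OF assms] by blast

end
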